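(* Let $m\ge 1$ be an integer, let $U$ be a unitary operator with eigenvector $|\psi\rangle$ and eigenvalue $e^{2\pi i\phi}$, $\phi\in[0,1)$, and write $\phi=\tilde\phi+\delta 2^{-m}$, where $\tilde\phi=0.\phi_1\phi_2\ldots\phi_m$ (binary) consists of the first $m$ bits of the binary expansion of $\phi$ and $0\le\delta<1$. Run the iterative phase estimation algorithm (IPEA, defined in the context) once, with one measurement per bit, obtaining bits $x_m,x_{m-1},\ldots,x_1$ and the estimate $\hat\phi=0.x_1x_2\ldots x_m$ (binary). Then: (i) the probability that $\hat\phi=\tilde\phi$ is $$P_{down}=\prod_{k=1}^m\cos^2\!\bigl(\pi 2^{k-1}\delta 2^{-m}\bigr)=\begin{cases}1,&\delta=0,\\[1mm] \dfrac{\sin^2(\pi\delta)}{2^{2m}\sin^2(\pi\delta 2^{-m})},&0<\delta<1;\end{cases}$$ (ii) the probability that $\hat\phi\equiv\tilde\phi+2^{-m}\pmod 1$ is $$P_{up}=\frac{\sin^2(\pi(1-\delta))}{2^{2m}\sin^2(\pi(1-\delta)2^{-m})};$$ (iii) consequently, the probability that $\hat\phi$ is one of $\tilde\phi$, $\tilde\phi+2^{-m}$ (mod $1$) is greater than $8/\pi^2$, i.e. the error probability is smaller than $1-8/\pi^2$, independently of $m$. The algorithm uses a single ancilla qubit, $O(m)$ iterations (measurements), and $O(2^m)$ applications of the controlled-$U$ gate.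
   Context: Binary notation: $0.b_1b_2\ldots b_r=\sum_{j=1}^r b_j2^{-j}$. IPEA: the iterations are indexed by $k$ and performed backwards, $k=m,m-1,\ldots,1$. In iteration $k$ a single ancilla qubit is prepared in $|0\rangle$ and the second register is in the state $|\psi\rangle$; one applies the Hadamard gate $H$ to the ancilla, then the controlled-$U^{2^{k-1}}$ gate (ancilla as control, second register as target; implemented by $2^{k-1}$ applications of controlled-$U$), then the rotation $R_z(\omega_k)=\mathrm{diag}(e^{-i\omega_k/2},e^{i\omega_k/2})$ to the ancilla, then $H$ to the ancilla, and finally measures the ancilla in the basis $\{|0\rangle,|1\rangle\}$, obtaining the bit $x_k$. The feedback angle is $\omega_m=0$ and, for $k<m$, $\omega_k=-2\pi(0.0x_{k+1}x_{k+2}\ldots x_m)$, which depends on the previously measured bits. Equivalently, conditioned on $x_{k+1},\ldots,x_m$, the outcome $x_k=0$ occurs with probability $\cos^2(\pi 2^{k-1}\phi+\omega_k/2)$ and $x_k=1$ with the complementary probability. *)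

theory Defs
  imports
    "HOL-Analysis.Analysis"
    "HOL-Probability.Probability"
    "HOL-Library.Landau_Symbols"
    "HOL-Library.Real_Mod"
begin

section \<open>Binary notation\<close>

text \<open>The real number $0.b_1 b_2 \ldots b_r$ for the list $[b_1, \ldots, b_r]$.\<close>

definition bin_frac :: "bool list \<Rightarrow> real" where
  "bin_frac bs = (\<Sum>j<length bs. of_bool (bs ! j) / 2 ^ Suc j)"

text \<open>
  The digit at position $k \ge 1$ after the binary point. For a dyadic rational this is the
  terminating expansion.
\<close>

definition binary_digit :: "real \<Rightarrow> nat \<Rightarrow> bool" where
  "binary_digit x k \<longleftrightarrow> odd \<lfloor>2 ^ k * x\<rfloor>"

definition truncate_bits :: "nat \<Rightarrow> real \<Rightarrow> real" where
  "truncate_bits m x = bin_frac (map (binary_digit x) [1..<Suc m])"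


section \<open>States and gates\<close>

text \<open>
  The ancilla wires are the elements of a finite type \<open>'w\<close>; the computational basis of the
  ancilla register is \<open>'w \<Rightarrow> bool\<close>, where \<open>False\<close> and \<open>True\<close> stand for $|0\rangle$ and
  $|1\rangle$. A vector indexed by \<open>('w \<Rightarrow> bool) \<times> 'n\<close> is an element of
  $(\mathbb{C}^2)^{\otimes w} \otimes \mathbb{C}^n$.
\<close>

type_synonym ('w, 'n) joint = "('w \<Rightarrow> bool) \<times> 'n"
type_synonym 'i operator = "complex ^ 'i ^ 'i"

definition conj_transpose :: "'i::finite operator \<Rightarrow> 'i operator" where
  "conj_transpose A = map_matrix cnj (transpose A)"

definition unitary :: "'i::finite operator \<Rightarrow> bool" where
  "unitary A \<longleftrightarrow> conj_transpose A ** A = mat 1 \<and> A ** conj_transpose A = mat 1"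

definition hadamard_gate :: "bool operator" where
  "hadamard_gate = (\<chi> a b. (if a \<and> b then - 1 else 1) / of_real (sqrt 2))"

definition rz_gate :: "real \<Rightarrow> bool operator" where
  "rz_gate \<omega> = (\<chi> a b. if a = b then (if a then cis (\<omega> / 2) else cis (- \<omega> / 2)) else 0)"

definition x_gate :: "bool operator" where
  "x_gate = (\<chi> a b. of_bool (a \<noteq> b))"

definition basis_projector :: "bool \<Rightarrow> bool operator" where
  "basis_projector c = (\<chi> a b. of_bool (a = c \<and> b = c))"

text \<open>The operator acting as \<open>G\<close> on the wire \<open>w\<close> and as the identity on everything else.\<close>

definition on_wire :: "'w::finite \<Rightarrow> bool operator \<Rightarrow> ('w, 'n::finite) joint operator" where
  "on_wire w G = (\<chi> p q.
     if snd p = snd q \<and> (\<forall>v. v \<noteq> w \<longrightarrow> fst p v = fst q v) then G $ fst p w $ fst q w else 0)"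

definition controlled :: "'w::finite \<Rightarrow> 'n::finite operator \<Rightarrow> ('w, 'n) joint operator" where
  "controlled w U = (\<chi> p q.
     if fst p = fst q then (if fst p w then U else mat 1) $ snd p $ snd q else 0)"

definition initial_state :: "complex ^ 'n \<Rightarrow> complex ^ ('w::finite, 'n::finite) joint" where
  "initial_state \<psi> = (\<chi> p. if fst p = (\<lambda>_. False) then \<psi> $ snd p else 0)"


section \<open>Measurement\<close>

text \<open>The Born rule for a unit vector \<open>s\<close>.\<close>

definition outcome :: "'w::finite \<Rightarrow> complex ^ ('w, 'n::finite) joint \<Rightarrow> bool pmf" where
  "outcome w s = bernoulli_pmf ((norm (on_wire w (basis_projector True) *v s))\<^sup>2)"

definition collapse ::
  "'w::finite \<Rightarrow> bool \<Rightarrow> complex ^ ('w, 'n::finite) joint \<Rightarrow> complex ^ ('w, 'n) joint" where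
  "collapse w b s = (let t = on_wire w (basis_projector b) *v s in (1 / norm t) *\<^sub>R t)"

text \<open>Resetting a wire to $|0\rangle$: measure it, forget the outcome, and flip it if needed.\<close>

definition reset ::
  "'w::finite \<Rightarrow> complex ^ ('w, 'n::finite) joint \<Rightarrow> (complex ^ ('w, 'n) joint) pmf" where
  "reset w s = map_pmf
     (\<lambda>b. if b then on_wire w x_gate *v collapse w True s else collapse w False s) (outcome w s)"


section \<open>Adaptive circuits\<close>

text \<open>
  The continuation of \<open>Measure\<close> depends on the observed bit. The target of the
  controlled gate is not part of the syntax, so that \<open>U\<close> is available only as a black box.
\<close>

datatype (ancillas: 'w) circuit =
    Halt
  | Prepare 'w "'w circuit"
  | Hadamard 'w "'w circuit"
  | RotZ real 'w "'w circuit"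
  | CtrlU 'w "'w circuit"
  | Measure 'w "bool \<Rightarrow> 'w circuit"

text \<open>The distribution of the list of measured bits, in chronological order.\<close>

primrec run ::
  "'n::finite operator \<Rightarrow> 'w::finite circuit \<Rightarrow> complex ^ ('w, 'n) joint \<Rightarrow> bool list pmf" where
  "run U Halt s = return_pmf []"
| "run U (Prepare w c) s = bind_pmf (reset w s) (run U c)"
| "run U (Hadamard w c) s = run U c (on_wire w hadamard_gate *v s)"
| "run U (RotZ \<omega> w c) s = run U c (on_wire w (rz_gate \<omega>) *v s)"
| "run U (CtrlU w c) s = run U c (controlled w U *v s)"
| "run U (Measure w f) s =
     bind_pmf (outcome w s) (\<lambda>b. map_pmf ((#) b) (run U (f b) (collapse w b s)))"

text \<open>Costs in the worst case over all measurement outcomes.\<close>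

primrec num_measurements :: "'w circuit \<Rightarrow> nat" where
  "num_measurements Halt = 0"
| "num_measurements (Prepare w c) = num_measurements c"
| "num_measurements (Hadamard w c) = num_measurements c"
| "num_measurements (RotZ \<omega> w c) = num_measurements c"
| "num_measurements (CtrlU w c) = num_measurements c"
| "num_measurements (Measure w f) =
     Suc (max (num_measurements (f False)) (num_measurements (f True)))"

primrec num_controlled :: "'w circuit \<Rightarrow> nat" where
  "num_controlled Halt = 0"
| "num_controlled (Prepare w c) = num_controlled c"
| "num_controlled (Hadamard w c) = num_controlled c"
| "num_controlled (RotZ \<omega> w c) = num_controlled c"
| "num_controlled (CtrlU w c) = Suc (num_controlled c)"
| "num_controlled (Measure w f) = max (num_controlled (f False)) (num_controlled (f True))"


section \<open>Iterative phase estimation\<close>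

text \<open>The angle $-2\pi\,(0.0x_{k+1}\ldots x_m)$ for the bits $[x_{k+1}, \ldots, x_m]$.\<close>

definition feedback_angle :: "bool list \<Rightarrow> real" where
  "feedback_angle xs = - 2 * pi * bin_frac (False # xs)"

text \<open>
  \<open>ipea_from w k xs\<close> performs the iterations $k, k-1, \ldots, 1$ after the bits
  \<open>xs\<close> $= [x_{k+1}, \ldots, x_m]$ have been measured.
\<close>

primrec ipea_from :: "'w \<Rightarrow> nat \<Rightarrow> bool list \<Rightarrow> 'w circuit" where
  "ipea_from w 0 xs = Halt"
| "ipea_from w (Suc k) xs =
     Prepare w (Hadamard w ((CtrlU w ^^ 2 ^ k) (RotZ (feedback_angle xs) w (Hadamard w
       (Measure w (\<lambda>x. ipea_from w k (x # xs)))))))"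

definition ipea :: "'w \<Rightarrow> nat \<Rightarrow> 'w circuit" where
  "ipea w m = ipea_from w m []"

text \<open>
  The distribution of the estimate $0.x_1 \ldots x_m$; the bits are measured in the order
  $x_m, \ldots, x_1$.
\<close>

definition ipea_estimate ::
  "'w::finite \<Rightarrow> nat \<Rightarrow> 'n::finite operator \<Rightarrow> complex ^ 'n \<Rightarrow> real pmf" where
  "ipea_estimate w m U \<psi> = map_pmf (\<lambda>r. bin_frac (rev r)) (run U (ipea w m) (initial_state \<psi>))"

end

theory Submission
  imports Defs
begin

text \<open>
  Every intermediate state is a product of an ancilla vector with \<open>\<psi>\<close>, so the quantum run
  collapses to a classical process on bits. Since $\sin^2 x = \cos^2(x - \pi/2)$, both outcomes of an
  iteration have probability $\cos^2(\pi(2^{k-1}\phi - 0.x_k x_{k+1}\ldots x_m))$, and the fraction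
  agrees with $2^{k-1}\hat\phi$ modulo $1$. Hence the estimate $\hat\phi$ has probability
  $\prod_{k=1}^m \cos^2(\pi 2^{k-1}(\phi - \hat\phi))$, which the double angle formula for the sine
  telescopes; both (i) and (ii) are instances. For (iii), $\sin x < x$ bounds the sum of the two
  probabilities below by $\sin^2(\pi\delta)\,(\delta^{-2} + (1-\delta)^{-2})/\pi^2$, and the numerator
  is at least $8$, with equality at $\delta = 1/2$.
\<close>

section \<open>Trigonometric estimates\<close>

text \<open>Halving the angle produces the factor \<open>cos (x / 2) < 1\<close>. This strictness is
  what makes the final bound strict when \<open>\<delta> > 0\<close>.\<close>

lemma sin_less_self:
  fixes x :: real
  assumes "0 < x" "x \<le> pi / 2"
  shows "sin x < x"
proof -
  have "cos (x / 2) < cos 0"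
    using assms by (subst cos_mono_less_eq) auto
  moreover have "0 < sin (x / 2)"
    using assms by (intro sin_gt_zero) auto
  ultimately have "2 * sin (x / 2) * cos (x / 2) < 2 * sin (x / 2) * 1"
    by (intro mult_strict_left_mono) auto
  also have "\<dots> \<le> x"
    using sin_x_le_x[of "x / 2"] assms by simp
  finally show ?thesis
    using sin_double[of "x / 2"] by simp
qed

text \<open>Maclaurin expansion with third-order remainder; the quadratic coefficient of the sine
  vanishes.\<close>

lemma sin_ge_cubic:
  fixes x :: real
  assumes "0 \<le> x"
  shows "x - x ^ 3 / 6 \<le> sin x"
proof -
  have "\<bar>sin x - x\<bar> \<le> x ^ 3 / 6"
    using Maclaurin_sin_bound[of x 3] assms
    by (simp add: sin_coeff_def numeral_3_eq_3 field_simps)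
  then show ?thesis by linarith
qed

text \<open>Follows from \<open>cos x = 1 - 2 * (sin (x / 2))\<^sup>2\<close> and the linear bound
  on the sine.\<close>

lemma cos_ge_quadratic: "1 - x\<^sup>2 / 2 \<le> cos x" for x :: real
proof -
  have "(sin (x / 2))\<^sup>2 \<le> (x / 2)\<^sup>2"
    using abs_sin_x_le_abs_x[of "x / 2"] by (simp only: abs_le_square_iff)
  then show ?thesis
    using cos_double_sin[of "x / 2"] by (simp add: power_divide)
qed

lemma pi_squared_le_10: "pi\<^sup>2 \<le> 10"
proof -
  have "pi\<^sup>2 \<le> (3.15)\<^sup>2"
    using pi_approx by (intro power_mono) auto
  then show ?thesis by (simp add: power2_eq_square)
qed

text \<open>Equality holds at \<open>d = 1 / 2\<close>, so an estimate sharp at that point is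
  required nearby, while a cruder one does for small \<open>d\<close>; hence the split.\<close>

lemma sin_inverse_squares_ge_half:
  fixes d :: real
  assumes "0 < d" "d \<le> 1 / 2"
  shows "8 \<le> (sin (pi * d))\<^sup>2 * (1 / d\<^sup>2 + 1 / (1 - d)\<^sup>2)"
proof (cases "d \<le> 1 / 5")
  case True
  text \<open>Here the summand $1/d^2$ alone suffices, as $\sin(\pi d) \geq 2\sqrt 2\, d$.\<close>
  have "d\<^sup>2 \<le> (1 / 5)\<^sup>2"
    using assms True by (intro power_mono) auto
  then have "pi\<^sup>2 * d\<^sup>2 \<le> 10 * (1 / 5)\<^sup>2"
    using pi_squared_le_10 by (intro mult_mono) auto
  \<comment> \<open>The previous bound is \<open>2 / 5\<close>, and
    \<open>1 - (2 / 5) / 6 = 14 / 15\<close>. The product is about 2.93, above the square root of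
    8.\<close>
  then have "3.14 * (14 / 15) \<le> pi * (1 - pi\<^sup>2 * d\<^sup>2 / 6)"
    using pi_approx by (intro mult_mono) (auto simp: power2_eq_square)
  then have "d * (3.14 * (14 / 15)) \<le> d * (pi * (1 - pi\<^sup>2 * d\<^sup>2 / 6))"
    using assms by (intro mult_left_mono) auto
  also have "\<dots> = pi * d - (pi * d) ^ 3 / 6"
    by (simp add: algebra_simps power2_eq_square power3_eq_cube)
  also have "\<dots> \<le> sin (pi * d)"
    using assms by (intro sin_ge_cubic) auto
  finally have "(d * (3.14 * (14 / 15)))\<^sup>2 \<le> (sin (pi * d))\<^sup>2"
    using assms by (intro power_mono) auto
  moreover have "8 * d\<^sup>2 \<le> (d * (3.14 * (14 / 15)))\<^sup>2"
    using assms by (simp add: power_mult_distrib power2_eq_square)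
  ultimately have "8 * d\<^sup>2 \<le> (sin (pi * d))\<^sup>2"
    by (rule order_trans[rotated])
  then have "8 \<le> (sin (pi * d))\<^sup>2 * (1 / d\<^sup>2)"
    using assms by (simp add: pos_le_divide_eq)
  also have "\<dots> \<le> (sin (pi * d))\<^sup>2 * (1 / d\<^sup>2 + 1 / (1 - d)\<^sup>2)"
    by (intro mult_left_mono) auto
  finally show ?thesis .
next
  case False
  text \<open>
    In terms of $u$ the claim is $\cos^2(\pi u/2)\,(1+u^2) \geq (1-u^2)^2$, and on $[0, 3/5]$ the
    quadratic minorant of the cosine is good enough.
  \<close>
  define u where "u = 1 - 2 * d"
  have u: "0 \<le> u" "u \<le> 3 / 5"
    using assms False by (auto simp: u_def)
  have v: "u\<^sup>2 \<le> (3 / 5)\<^sup>2"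
    using u by (intro power_mono) auto
  have "sin (pi * d) = cos (pi / 2 * u)"
    by (simp add: u_def sin_cos_eq algebra_simps)
  \<comment> \<open>The coefficient is \<open>10 / 8\<close>, from bounding
    \<open>pi\<^sup>2 / 8\<close>.\<close>
  moreover have "1 - 5 / 4 * u\<^sup>2 \<le> 1 - (pi / 2 * u)\<^sup>2 / 2"
    using mult_right_mono[OF pi_squared_le_10, of "u\<^sup>2"] by (simp add: power_mult_distrib power_divide)
  ultimately have "1 - 5 / 4 * u\<^sup>2 \<le> sin (pi * d)"
    using cos_ge_quadratic[of "pi / 2 * u"] by simp
  then have s: "(1 - 5 / 4 * u\<^sup>2)\<^sup>2 \<le> (sin (pi * d))\<^sup>2"
    using v by (intro power_mono) (auto simp: power2_eq_square)
  \<comment> \<open>Up to the factor \<open>25 / 16\<close>, this product has the linear and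
    quadratic coefficients in \<open>u\<^sup>2\<close> of the polynomial below, and a slightly
    smaller constant term (198/625 against 200/625). Its smaller root is the upper bound on
    \<open>u\<^sup>2\<close>.\<close>
  have "0 \<le> (9 / 25 - u\<^sup>2) * (22 / 25 - u\<^sup>2)"
    using v by (intro mult_nonneg_nonneg) (auto simp: power2_eq_square)
  then have "0 \<le> 1 / 2 - 31 / 16 * u\<^sup>2 + 25 / 16 * (u\<^sup>2 * u\<^sup>2)"
    by (simp add: algebra_simps)
  then have "0 \<le> u\<^sup>2 * (1 / 2 - 31 / 16 * u\<^sup>2 + 25 / 16 * (u\<^sup>2 * u\<^sup>2))"
    by (intro mult_nonneg_nonneg) auto
  also have "\<dots> = (1 - 5 / 4 * u\<^sup>2)\<^sup>2 * (1 + u\<^sup>2) - (1 - u\<^sup>2)\<^sup>2"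
    by (simp add: power2_eq_square field_simps)
  finally have "(1 - u\<^sup>2)\<^sup>2 \<le> (1 - 5 / 4 * u\<^sup>2)\<^sup>2 * (1 + u\<^sup>2)"
    by simp
  also have "\<dots> \<le> (sin (pi * d))\<^sup>2 * (1 + u\<^sup>2)"
    using s by (intro mult_right_mono) auto
  finally have "8 * (1 - u\<^sup>2)\<^sup>2 \<le> (sin (pi * d))\<^sup>2 * (8 * (1 + u\<^sup>2))"
    by linarith
  moreover have "1 - u\<^sup>2 \<noteq> 0"
    using v by (auto simp: power2_eq_square)
  ultimately have "8 \<le> (sin (pi * d))\<^sup>2 * (8 * (1 + u\<^sup>2) / (1 - u\<^sup>2)\<^sup>2)"
    by (simp add: pos_le_divide_eq)
  also have "1 - u\<^sup>2 = 4 * (d * (1 - d))"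
    by (simp add: u_def power2_eq_square algebra_simps)
  also have "1 + u\<^sup>2 = 2 * (d\<^sup>2 + (1 - d)\<^sup>2)"
    by (simp add: u_def power2_eq_square algebra_simps)
  also have "8 * (2 * (d\<^sup>2 + (1 - d)\<^sup>2)) / (4 * (d * (1 - d)))\<^sup>2 = 1 / d\<^sup>2 + 1 / (1 - d)\<^sup>2"
    using assms by (simp add: power_mult_distrib divide_simps)
  finally show ?thesis .
qed

lemma sin_inverse_squares_ge:
  fixes d :: real
  assumes "0 < d" "d < 1"
  shows "8 \<le> (sin (pi * d))\<^sup>2 * (1 / d\<^sup>2 + 1 / (1 - d)\<^sup>2)"
proof (cases "d \<le> 1 / 2")
  case True
  then show ?thesis using assms sin_inverse_squares_ge_half by simp
next
  case False
  have "sin (pi * (1 - d)) = sin (pi * d)"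
    by (simp add: right_diff_distrib)
  then show ?thesis
    using sin_inverse_squares_ge_half[of "1 - d"] False assms by (simp add: add.commute)
qed

section \<open>Telescoping products of cosines and bounds on the resulting ratios\<close>

text \<open>Each doubling of the angle releases one cosine factor. The multiplied-out form avoids
  division by a vanishing sine.\<close>

lemma prod_cos_squared_sin_squared:
  fixes x :: real
  shows "(\<Prod>k<m. (cos (2 ^ k * x))\<^sup>2) * (2 ^ (2 * m) * (sin x)\<^sup>2) = (sin (2 ^ m * x))\<^sup>2"
proof (induction m)
  case (Suc m)
  have "(sin (2 ^ Suc m * x))\<^sup>2 = 4 * (cos (2 ^ m * x))\<^sup>2 * (sin (2 ^ m * x))\<^sup>2"
    using sin_double[of "2 ^ m * x"] by (simp add: power_mult_distrib mult_ac)
  then show ?case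
    unfolding Suc.IH[symmetric] by (simp add: mult_ac)
qed simp

text \<open>Positivity of \<open>m\<close> keeps \<open>t / 2 ^ m\<close> below 1, so the sine in
  the denominator is positive. The value \<open>t = 1\<close> is included because
  \<open>1 - \<delta>\<close> attains it at \<open>\<delta> = 0\<close>.\<close>

lemma prod_cos_squared:
  fixes t :: real
  assumes "0 < t" "t \<le> 1" "0 < m"
  shows "(\<Prod>k<m. (cos (pi * (2 ^ k * (t / 2 ^ m))))\<^sup>2) =
    (sin (pi * t))\<^sup>2 / (2 ^ (2 * m) * (sin (pi * (t / 2 ^ m)))\<^sup>2)"
proof -
  have "1 < (2::real) ^ m"
    using assms by (intro one_less_power) auto
  then have "t < 2 ^ m"
    using assms by linarith
  then have "pi * (t / 2 ^ m) < pi * 1"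
    by (intro mult_strict_left_mono) auto
  then have "sin (pi * (t / 2 ^ m)) > 0"
    using assms by (intro sin_gt_zero) auto
  then show ?thesis
    using prod_cos_squared_sin_squared[where x = "pi * (t / 2 ^ m)" and m = m]
    by (simp add: nonzero_eq_divide_eq mult_ac)
qed

text \<open>Replacing the sine in the denominator by its argument cancels the powers of two, which
  makes the lower bound independent of \<open>m\<close>.\<close>

lemma sin_squared_ratio_gt:
  fixes t :: real
  assumes "0 < t" "t < 1" "0 < m"
  shows "(sin (pi * t))\<^sup>2 / (pi\<^sup>2 * t\<^sup>2) < (sin (pi * t))\<^sup>2 / (2 ^ (2 * m) * (sin (pi * (t / 2 ^ m)))\<^sup>2)"
proof -
  define y where "y = pi * (t / 2 ^ m)"
  have "2 ^ 1 \<le> (2::real) ^ m"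
    using assms by (intro power_increasing) auto
  then have "t / 2 ^ m \<le> 1 / 2"
    using assms frac_le[of 1 t 2 "2 ^ m"] by simp
  then have y: "0 < y" "y \<le> pi / 2"
    using assms mult_left_mono[of "t / 2 ^ m" "1 / 2" pi] by (auto simp: y_def)
  then have "0 < sin y"
    by (intro sin_gt_zero) auto
  moreover have "sin y < y"
    by (rule sin_less_self[OF y])
  ultimately have "(2 ^ m * sin y)\<^sup>2 < (2 ^ m * y)\<^sup>2" and "0 < (2 ^ m * sin y)\<^sup>2"
    by (auto intro!: power_strict_mono)
  moreover have "2 ^ m * y = pi * t"
    by (simp add: y_def)
  moreover have "0 < sin (pi * t)"
    using assms by (intro sin_gt_zero) auto
  ultimately show ?thesis
    unfolding y_def[symmetric]
    by (intro divide_strict_left_mono)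
       (auto simp: power_mult_distrib power_mult mult.commute[of 2 m] power_even_eq zero_less_mult_iff)
qed

lemma sin_ratio_sum_gt:
  fixes t :: real
  assumes "0 < t" "t < 1" "0 < m"
  shows "8 / pi\<^sup>2 < (sin (pi * t))\<^sup>2 / (2 ^ (2 * m) * (sin (pi * (t / 2 ^ m)))\<^sup>2)
    + (sin (pi * (1 - t)))\<^sup>2 / (2 ^ (2 * m) * (sin (pi * ((1 - t) / 2 ^ m)))\<^sup>2)"
proof -
  have "8 / pi\<^sup>2 \<le> (sin (pi * t))\<^sup>2 * (1 / t\<^sup>2 + 1 / (1 - t)\<^sup>2) / pi\<^sup>2"
    using sin_inverse_squares_ge[of t] assms by (intro divide_right_mono) auto
  also have "\<dots> = (sin (pi * t))\<^sup>2 / (pi\<^sup>2 * t\<^sup>2) + (sin (pi * t))\<^sup>2 / (pi\<^sup>2 * (1 - t)\<^sup>2)"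
    using assms by (simp add: field_simps)
  also have "(sin (pi * t))\<^sup>2 = (sin (pi * (1 - t)))\<^sup>2"
    by (simp add: right_diff_distrib)
  finally have "8 / pi\<^sup>2 \<le> (sin (pi * t))\<^sup>2 / (pi\<^sup>2 * t\<^sup>2) + (sin (pi * (1 - t)))\<^sup>2 / (pi\<^sup>2 * (1 - t)\<^sup>2)"
    by (simp add: right_diff_distrib)
  then show ?thesis
    using sin_squared_ratio_gt[of t m] sin_squared_ratio_gt[of "1 - t" m] assms by simp
qed

text \<open>A shift by an integer multiple of \<open>pi\<close> only changes the sign of the cosine.
  Phases therefore matter only modulo 1.\<close>

lemma cos_squared_cong_Ints:
  assumes "x - y \<in> \<int>"
  shows "(cos (pi * x))\<^sup>2 = (cos (pi * y))\<^sup>2"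
proof -
  obtain n :: int where "x = y + of_int n"
    using assms by (auto elim!: Ints_cases simp: algebra_simps)
  then have "cos (pi * x) = cos (pi * y) * cos (pi * of_int n)"
    by (simp add: distrib_left cos_add sin_zero_iff_int2 mult.commute)
  moreover have "(cos (pi * of_int n))\<^sup>2 = 1"
    by (simp add: cos_squared_eq)
  ultimately show ?thesis
    by (simp add: power_mult_distrib)
qed


section \<open>Binary fractions\<close>

lemma bin_frac_Nil [simp]: "bin_frac [] = 0"
  by (simp add: bin_frac_def)

lemma bin_frac_Cons: "bin_frac (b # bs) = (of_bool b + bin_frac bs) / 2"
  by (simp add: bin_frac_def sum.lessThan_Suc_shift sum_divide_distrib add_divide_distrib del: sum.lessThan_Suc)

lemma bin_frac_bounds: "0 \<le> bin_frac bs" "bin_frac bs < 1"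
  by (induction bs) (auto simp: bin_frac_Cons)

text \<open>The tail lies in \<open>[0, 1)\<close>, so doubling the fraction exposes the leading bit
  as its integer part. Equal lengths exclude trailing zeros.\<close>

lemma bin_frac_inject:
  assumes "length bs = length cs" "bin_frac bs = bin_frac cs"
  shows "bs = cs"
  using assms
proof (induction bs cs rule: list_induct2)
  case (Cons b bs c cs)
  then have "of_bool b + bin_frac bs = of_bool c + bin_frac cs"
    by (simp add: bin_frac_Cons)
  then have "b = c"
    using bin_frac_bounds[of bs] bin_frac_bounds[of cs] by (cases b; cases c) auto
  then show ?case
    using Cons by (simp add: bin_frac_Cons)
qed simp

lemma bin_frac_surj:
  assumes "n < 2 ^ m"
  shows "\<exists>bs. length bs = m \<and> bin_frac bs = real n / 2 ^ m"
  using assms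
proof (induction m arbitrary: n)
  case (Suc m)
  define b where "b \<longleftrightarrow> 2 ^ m \<le> n"
  define n' where "n' = n - of_bool b * 2 ^ m"
  have n: "n = of_bool b * 2 ^ m + n'" and "n' < 2 ^ m"
    using Suc.prems by (auto simp: n'_def b_def)
  then obtain bs where "length bs = m" "bin_frac bs = real n' / 2 ^ m"
    using Suc.IH by blast
  then have "length (b # bs) = Suc m" "bin_frac (b # bs) = real n / 2 ^ Suc m"
    by (auto simp: bin_frac_Cons n field_simps)
  then show ?case by blast
qed simp

lemma bin_frac_dyadic: "\<exists>n. bin_frac bs = real n / 2 ^ length bs \<and> n < 2 ^ length bs"
proof -
  have "\<exists>n. bin_frac bs = real n / 2 ^ length bs"
  proof (induction bs)
    case (Cons b bs)
    then obtain n where "bin_frac bs = real n / 2 ^ length bs" by blast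
    then have "bin_frac (b # bs) = real (of_bool b * 2 ^ length bs + n) / 2 ^ length (b # bs)"
      by (simp add: bin_frac_Cons field_simps)
    then show ?case by blast
  qed simp
  then obtain n where n: "bin_frac bs = real n / 2 ^ length bs" ..
  then have "real n < real (2 ^ length bs)"
    using bin_frac_bounds(2)[of bs] by simp
  then show ?thesis
    using n by (auto simp only: of_nat_less_iff)
qed

text \<open>Increment the numerator; if it overflows, the fraction reaches 1 and wraps around to the
  zero string. This supplies the bits of the rounded-up estimate.\<close>

lemma bin_frac_successor:
  "\<exists>cs. length cs = length bs \<and> [bin_frac cs = bin_frac bs + 1 / 2 ^ length bs] (rmod 1)"
proof -
  obtain n where n: "bin_frac bs = real n / 2 ^ length bs" "n < 2 ^ length bs"
    using bin_frac_dyadic by blast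
  show ?thesis
  proof (cases "Suc n < 2 ^ length bs")
    case True
    then obtain cs where "length cs = length bs" "bin_frac cs = real (Suc n) / 2 ^ length bs"
      using bin_frac_surj by blast
    then show ?thesis
      using n by (intro exI[of _ cs]) (simp add: add_divide_distrib add.commute)
  next
    case False
    then have "Suc n = 2 ^ length bs"
      using n by simp
    then have "real n + 1 = 2 ^ length bs"
      by (metis of_nat_Suc of_nat_numeral of_nat_power add.commute)
    then have "bin_frac bs + 1 / 2 ^ length bs = 1"
      by (simp add: n add_divide_distrib[symmetric])
    moreover obtain cs where "length cs = length bs" "bin_frac cs = 0"
      using bin_frac_surj[of 0 "length bs"] by auto
    ultimately show ?thesis
      by (intro exI[of _ cs]) (auto simp: rcong_altdef)
  qed
qed

lemma bin_frac_rcong_inject: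
  assumes "length bs = length cs" "[bin_frac bs = bin_frac cs] (rmod 1)"
  shows "bs = cs"
proof (rule bin_frac_inject)
  obtain n :: int where "bin_frac cs = bin_frac bs + of_int n"
    using assms(2) by (auto simp: rcong_altdef)
  then show "bin_frac bs = bin_frac cs"
    using bin_frac_bounds[of bs] bin_frac_bounds[of cs] by simp
qed fact

text \<open>Multiplication by \<open>2 ^ j\<close> moves the first \<open>j\<close> bits in front of
  the binary point, where they form an integer.\<close>

lemma power_mult_bin_frac:
  assumes "j \<le> length bs"
  shows "2 ^ j * bin_frac bs - bin_frac (drop j bs) \<in> \<int>"
  using assms
proof (induction j arbitrary: bs)
  case (Suc j)
  then obtain b cs where bs: "bs = b # cs"
    by (cases bs) auto
  have "2 ^ Suc j * bin_frac bs - bin_frac (drop (Suc j) bs)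
      = 2 ^ j * of_bool b + (2 ^ j * bin_frac cs - bin_frac (drop j cs))"
    by (simp add: bs bin_frac_Cons field_simps)
  also have "\<dots> \<in> \<int>"
    using Suc by (intro Ints_add Suc.IH) (auto simp: bs)
  finally show ?case .
qed simp


section \<open>Gates and measurements on product states\<close>

text \<open>The ancilla \<open>w\<close> in state \<open>a\<close>, all other wires in $|0\rangle$, the second register in \<open>\<psi>\<close>.\<close>

definition wire_state ::
  "'w \<Rightarrow> complex ^ 'n \<Rightarrow> (bool \<Rightarrow> complex) \<Rightarrow> complex ^ ('w::finite, 'n::finite) joint" where
  "wire_state w \<psi> a =
     (\<chi> p. if \<forall>v. v \<noteq> w \<longrightarrow> \<not> fst p v then a (fst p w) * \<psi> $ snd p else 0)"

lemma initial_state_eq_wire_state: "initial_state \<psi> = wire_state w \<psi> (\<lambda>b. of_bool (\<not> b))"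
  by (auto simp: initial_state_def wire_state_def vec_eq_iff fun_eq_iff)

text \<open>The row of index \<open>p\<close> is supported on the two indices that agree with
  \<open>p\<close> off the wire \<open>w\<close>.\<close>

lemma on_wire_mult_nth:
  "(on_wire w G *v s) $ p = (\<Sum>c\<in>UNIV. G $ fst p w $ c * s $ ((fst p)(w := c), snd p))"
proof -
  let ?f = "\<lambda>c. ((fst p)(w := c), snd p)"
  have "(on_wire w G *v s) $ p = (\<Sum>q\<in>UNIV. on_wire w G $ p $ q * s $ q)"
    by (simp add: matrix_vector_mult_def)
  also have "\<dots> = (\<Sum>q\<in>range ?f. on_wire w G $ p $ q * s $ q)"
  proof (intro sum.mono_neutral_right ballI)
    fix q assume "q \<in> UNIV - range ?f"
    then have "q \<noteq> ?f (fst q w)"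
      by blast
    moreover have "q = ?f (fst q w)" if "snd p = snd q" "\<forall>v. v \<noteq> w \<longrightarrow> fst p v = fst q v"
      using that by (auto simp: prod_eq_iff fun_eq_iff)
    ultimately have "\<not> (snd p = snd q \<and> (\<forall>v. v \<noteq> w \<longrightarrow> fst p v = fst q v))"
      by blast
    then show "on_wire w G $ p $ q * s $ q = 0"
      by (auto simp: on_wire_def)
  qed auto
  also have "\<dots> = (\<Sum>c\<in>UNIV. on_wire w G $ p $ ?f c * s $ ?f c)"
  proof (subst sum.reindex)
    show "inj ?f"
      by (rule injI) (metis fst_conv fun_upd_same)
  qed simp
  finally show ?thesis
    by (simp add: on_wire_def)
qed

text \<open>Product states are preserved: the gate acts on the two ancilla amplitudes alone.\<close>

lemma on_wire_wire_state:
  "on_wire w G *v wire_state w \<psi> a = wire_state w \<psi> (\<lambda>b. \<Sum>c\<in>UNIV. G $ b $ c * a c)"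
  by (auto simp: vec_eq_iff on_wire_mult_nth wire_state_def sum_distrib_right mult.assoc intro!: sum.neutral)

lemma controlled_mult_nth:
  "(controlled w U *v s) $ p =
     (\<Sum>n\<in>UNIV. (if fst p w then U else mat 1) $ snd p $ n * s $ (fst p, n))"
proof -
  have "(controlled w U *v s) $ p = (\<Sum>q\<in>UNIV \<times> UNIV. controlled w U $ p $ q * s $ q)"
    by (simp add: matrix_vector_mult_def)
  also have "\<dots> = (\<Sum>f\<in>UNIV. \<Sum>n\<in>UNIV. controlled w U $ p $ (f, n) * s $ (f, n))"
    by (simp add: sum.cartesian_product)
  also have "\<dots> = (\<Sum>f\<in>UNIV. if fst p = f
      then \<Sum>n\<in>UNIV. (if fst p w then U else mat 1) $ snd p $ n * s $ (fst p, n) else 0)"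
    by (intro sum.cong) (auto simp: controlled_def)
  finally show ?thesis
    by simp
qed

text \<open>Phase kickback: the eigenvalue lands on the amplitude of the control being
  \<open>True\<close>, and the second register stays in \<open>\<psi>\<close>.\<close>

lemma controlled_wire_state:
  assumes "U *v \<psi> = c *s \<psi>"
  shows "controlled w U *v wire_state w \<psi> a = wire_state w \<psi> (\<lambda>b. (if b then c else 1) * a b)"
proof -
  have "(\<Sum>n\<in>UNIV. (if b then U else mat 1) $ i $ n * \<psi> $ n) = (if b then c else 1) * \<psi> $ i" for b i
  proof -
    have "((if b then U else mat 1) *v \<psi>) $ i = (if b then c else 1) * \<psi> $ i"
      using assms by auto
    then show ?thesis
      by (simp only: matrix_vector_mult_def vec_lambda_beta)
  qed
  then have eq: "(\<Sum>n\<in>UNIV. (if b then U else mat 1) $ i $ n * (x * \<psi> $ n)) = (if b then c else 1) * x * \<psi> $ i" for b i x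
    by (simp add: sum_distrib_left[symmetric] mult.left_commute[of _ x])
  have "(controlled w U *v wire_state w \<psi> a) $ p = wire_state w \<psi> (\<lambda>b. (if b then c else 1) * a b) $ p" for p
  proof (cases "\<forall>v. v \<noteq> w \<longrightarrow> \<not> fst p v")
    case True
    then have "wire_state w \<psi> a $ (fst p, n) = a (fst p w) * \<psi> $ n" for n
      by (simp add: wire_state_def)
    then show ?thesis
      using True by (simp only: controlled_mult_nth eq) (simp add: wire_state_def)
  next
    case False
    then have "wire_state w \<psi> a $ (fst p, n) = 0" for n
      by (auto simp: wire_state_def)
    then show ?thesis
      using False by (simp only: controlled_mult_nth mult_zero_right) (auto simp: wire_state_def)
  qed
  then show ?thesis
    by (intro iffD2[OF vec_eq_iff] allI)
qed

text \<open>The state is supported on an embedded copy of \<open>bool\<close> times the index set of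
  \<open>\<psi>\<close>, over which the sum of squares factorises.\<close>

lemma norm_wire_state:
  fixes \<psi> :: "complex ^ 'n::finite" and w :: "'w::finite"
  assumes "norm \<psi> = 1"
  shows "(norm (wire_state w \<psi> a))\<^sup>2 = (\<Sum>b\<in>UNIV. (norm (a b))\<^sup>2)"
proof -
  let ?g = "\<lambda>(b, n :: 'n). ((\<lambda>_. False)(w := b), n)"
  have "(norm (wire_state w \<psi> a))\<^sup>2 = (\<Sum>p\<in>UNIV. (norm (wire_state w \<psi> a $ p))\<^sup>2)"
    by (simp add: norm_vec_def L2_set_def sum_nonneg)
  also have "\<dots> = (\<Sum>p\<in>range ?g. (norm (wire_state w \<psi> a $ p))\<^sup>2)"
  proof (intro sum.mono_neutral_right ballI)
    fix p assume "p \<in> UNIV - range ?g"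
    then have "p \<noteq> ?g (fst p w, snd p)"
      by blast
    moreover have "p = ?g (fst p w, snd p)" if "\<forall>v. v \<noteq> w \<longrightarrow> \<not> fst p v"
      using that by (auto simp: prod_eq_iff fun_eq_iff)
    ultimately have "\<not> (\<forall>v. v \<noteq> w \<longrightarrow> \<not> fst p v)"
      by blast
    then show "(norm (wire_state w \<psi> a $ p))\<^sup>2 = 0"
      by (simp only: wire_state_def vec_lambda_beta if_False) simp
  qed auto
  also have "\<dots> = (\<Sum>(b, n)\<in>UNIV. (norm (wire_state w \<psi> a $ ?g (b, n)))\<^sup>2)"
  proof (subst sum.reindex)
    show "inj ?g"
      by (rule injI) (auto simp: fun_eq_iff split: if_splits)
  qed (simp add: case_prod_unfold)
  also have "\<dots> = (\<Sum>(b, n)\<in>UNIV \<times> UNIV. (norm (a b))\<^sup>2 * (norm (\<psi> $ n))\<^sup>2)"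
    by (simp add: wire_state_def norm_mult power_mult_distrib)
  also have "\<dots> = (\<Sum>b\<in>UNIV. (norm (a b))\<^sup>2) * (\<Sum>n\<in>UNIV. (norm (\<psi> $ n))\<^sup>2)"
    by (simp only: sum_product sum.cartesian_product)
  also have "(\<Sum>n\<in>UNIV. (norm (\<psi> $ n))\<^sup>2) = (norm \<psi>)\<^sup>2"
    by (simp add: norm_vec_def L2_set_def sum_nonneg)
  finally show ?thesis
    using assms by simp
qed

lemma scaleR_wire_state: "r *\<^sub>R wire_state w \<psi> a = wire_state w \<psi> (\<lambda>b. r *\<^sub>R a b)"
  by (auto simp: vec_eq_iff wire_state_def)

lemma outcome_wire_state:
  assumes "norm \<psi> = 1"
  shows "outcome w (wire_state w \<psi> a) = bernoulli_pmf ((norm (a True))\<^sup>2)"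
  using assms
  by (simp add: outcome_def on_wire_wire_state norm_wire_state UNIV_bool basis_projector_def)

text \<open>Normalisation keeps the phase of the surviving amplitude, which is
  \<open>sgn (a b)\<close>. If \<open>a b = 0\<close>, both sides are zero, by
  \<open>1 / 0 = 0\<close> and \<open>sgn 0 = 0\<close>.\<close>

lemma collapse_wire_state:
  assumes "norm \<psi> = 1"
  shows "collapse w b (wire_state w \<psi> a) = wire_state w \<psi> (\<lambda>c. of_bool (c = b) * sgn (a b))"
proof -
  have p: "on_wire w (basis_projector b) *v wire_state w \<psi> a
      = wire_state w \<psi> (\<lambda>c. of_bool (c = b) * a b)"
    unfolding on_wire_wire_state
    by (rule arg_cong[of _ _ "wire_state w \<psi>"], rule ext, cases b)
       (auto simp: UNIV_bool basis_projector_def)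
  have "(norm (wire_state w \<psi> (\<lambda>c. of_bool (c = b) * a b)))\<^sup>2 = (norm (a b))\<^sup>2"
    using assms by (cases b) (auto simp: norm_wire_state UNIV_bool)
  then have "norm (wire_state w \<psi> (\<lambda>c. of_bool (c = b) * a b)) = norm (a b)"
    by simp
  then show ?thesis
    by (simp add: collapse_def p scaleR_wire_state sgn_div_norm inverse_eq_divide)
qed

text \<open>A basis state up to a phase is measured with certainty, so the reset is deterministic
  and carries the global phase \<open>c\<close> along.\<close>

lemma reset_wire_state:
  assumes "norm \<psi> = 1" "norm c = 1"
  shows "reset w (wire_state w \<psi> (\<lambda>d. of_bool (d = b) * c)) =
    return_pmf (wire_state w \<psi> (\<lambda>d. of_bool (\<not> d) * c))"
proof -
  have c: "sgn c = c"
    using assms by (simp add: sgn_div_norm)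
  have "bernoulli_pmf (of_bool b) = return_pmf b" for b
    by (rule pmf_eqI) (rename_tac x, case_tac x; cases b; simp)
  from this[of b] have o: "outcome w (wire_state w \<psi> (\<lambda>d. of_bool (d = b) * c)) = return_pmf b"
    using assms by (cases b) (simp_all add: outcome_wire_state)
  have x: "on_wire w x_gate *v wire_state w \<psi> (\<lambda>d. of_bool d * c) = wire_state w \<psi> (\<lambda>d. of_bool (\<not> d) * c)"
    unfolding on_wire_wire_state
    by (rule arg_cong[of _ _ "wire_state w \<psi>"], rule ext) (auto simp: UNIV_bool x_gate_def)
  show ?thesis
    unfolding reset_def o map_return_pmf
    using assms x c by (cases b) (simp_all add: collapse_wire_state)
qed

text \<open>
  The exponent is \<open>k\<close> rather than $k-1$: \<open>bit_pmf \<phi> k\<close> is the outcome of iteration $k+1$.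
\<close>

definition bit_pmf :: "real \<Rightarrow> nat \<Rightarrow> bool list \<Rightarrow> bool pmf" where
  "bit_pmf \<phi> k xs = bernoulli_pmf ((sin (pi * (2 ^ k * \<phi> - bin_frac (False # xs))))\<^sup>2)"

primrec bits_pmf :: "real \<Rightarrow> nat \<Rightarrow> bool list \<Rightarrow> bool list pmf" where
  "bits_pmf \<phi> 0 xs = return_pmf []"
| "bits_pmf \<phi> (Suc k) xs =
     bind_pmf (bit_pmf \<phi> k xs) (\<lambda>b. map_pmf ((#) b) (bits_pmf \<phi> k (b # xs)))"

section \<open>Reduction of the circuit to the classical bit process\<close>

lemma run_CtrlU_power:
  assumes "U *v \<psi> = c *s \<psi>"
  shows "run U ((CtrlU w ^^ n) C) (wire_state w \<psi> a) =
    run U C (wire_state w \<psi> (\<lambda>b. (if b then c ^ n else 1) * a b))"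
proof (induction n arbitrary: a)
  case 0
  have "(\<lambda>b. (if b then c ^ 0 else 1) * a b) = a"
    by auto
  then show ?case by simp
next
  case (Suc n)
  have "(if b then c ^ n else 1) * ((if b then c else 1) * a b) = (if b then c ^ Suc n else 1) * a b" for b
    by simp
  then show ?case
    by (simp only: funpow.simps o_apply run.simps controlled_wire_state[OF assms] Suc.IH)
qed

lemma hadamard_wire_state:
  "on_wire w hadamard_gate *v wire_state w \<psi> a =
     wire_state w \<psi> (\<lambda>b. (a False + (if b then - 1 else 1) * a True) / sqrt 2)"
  unfolding on_wire_wire_state
  by (rule arg_cong[of _ _ "wire_state w \<psi>"], rule ext)
     (auto simp: UNIV_bool hadamard_gate_def add_divide_distrib)

lemma rz_wire_state:
  "on_wire w (rz_gate \<omega>) *v wire_state w \<psi> a =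
     wire_state w \<psi> (\<lambda>b. cis (if b then \<omega> / 2 else - \<omega> / 2) * a b)"
  unfolding on_wire_wire_state
  by (rule arg_cong[of _ _ "wire_state w \<psi>"], rule ext) (auto simp: UNIV_bool rz_gate_def)

text \<open>Squared length of a chord of the unit circle, by the cosine rule: the interference of
  the two branches that gives the outcome \<open>True\<close>.\<close>

lemma norm_cis_diff: "(norm (cis x - cis y))\<^sup>2 = 4 * (sin ((y - x) / 2))\<^sup>2"
proof -
  have "(norm (cis x - cis y))\<^sup>2 = ((sin x)\<^sup>2 + (cos x)\<^sup>2) + ((sin y)\<^sup>2 + (cos y)\<^sup>2) - 2 * cos (y - x)"
    by (simp only: cmod_power2 minus_complex.sel cis.sel cos_diff) algebra
  also have "cos (y - x) = cos (2 * ((y - x) / 2))"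
    by (rule arg_cong[of _ _ cos]) (simp add: field_simps)
  finally show ?thesis
    by (simp only: cos_double_sin sin_cos_squared_add) simp
qed

lemma norm_cis_add: "(norm (cis x + cis y))\<^sup>2 = 4 * (cos ((y - x) / 2))\<^sup>2"
proof -
  have "(norm (cis x + cis y))\<^sup>2 = ((sin x)\<^sup>2 + (cos x)\<^sup>2) + ((sin y)\<^sup>2 + (cos y)\<^sup>2) + 2 * cos (y - x)"
    by (simp only: cmod_power2 plus_complex.sel cis.sel cos_diff) algebra
  also have "cos (y - x) = cos (2 * ((y - x) / 2))"
    by (rule arg_cong[of _ _ cos]) (simp add: field_simps)
  finally show ?thesis
    by (simp only: cos_double_cos sin_cos_squared_add) simp
qed

text \<open>The measured bit leaves behind a global phase \<open>d b\<close>. Its modulus is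
  asserted only on the support, since \<open>sgn\<close> of a zero amplitude is 0.\<close>

lemma run_iteration:
  fixes \<psi> :: "complex ^ 'n::finite" and w :: "'w::finite"
  assumes "norm \<psi> = 1" "norm c = 1" "U *v \<psi> = cis (2 * pi * \<phi>) *s \<psi>"
  shows "\<exists>d. (\<forall>b\<in>set_pmf (bit_pmf \<phi> k xs). norm (d b) = 1) \<and>
    run U (Prepare w (Hadamard w ((CtrlU w ^^ 2 ^ k) (RotZ (feedback_angle xs) w (Hadamard w
       (Measure w f)))))) (wire_state w \<psi> (\<lambda>b. of_bool (b = b0) * c)) =
    bind_pmf (bit_pmf \<phi> k xs) (\<lambda>b. map_pmf ((#) b)
       (run U (f b) (wire_state w \<psi> (\<lambda>b'. of_bool (b' = b) * d b))))"
proof -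
  define \<omega> where "\<omega> = feedback_angle xs"
  define p where "p = (sin (pi * (2 ^ k * \<phi> - bin_frac (False # xs))))\<^sup>2"
  \<comment> \<open>The ancilla amplitudes just before the measurement, in the shape in which the
    gate lemmas deliver them.\<close>
  define a where "a b = (cis (- \<omega> / 2) * (c / sqrt 2) + (if b then - 1 else 1) *
    (cis (\<omega> / 2) * (cis (2 * pi * \<phi>) ^ 2 ^ k * (c / sqrt 2)))) / sqrt 2" for b
  \<comment> \<open>Total phase of the \<open>True\<close> branch: half the feedback angle plus the
    kicked-back phase.\<close>
  define y where "y = \<omega> / 2 + 2 ^ k * (2 * pi * \<phi>)"
  have a: "a b = c * (cis (- \<omega> / 2) + (if b then - 1 else 1) * cis y) / 2" for b
  proof -
    have "cis (2 * pi * \<phi>) ^ 2 ^ k = cis (2 ^ k * (2 * pi * \<phi>))"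
      using Complex.DeMoivre[of "2 * pi * \<phi>" "2 ^ k"] by simp
    then have "cis y = cis (\<omega> / 2) * cis (2 * pi * \<phi>) ^ 2 ^ k"
      by (simp only: y_def cis_mult)
    moreover have "complex_of_real (sqrt 2) * complex_of_real (sqrt 2) = 2"
      by (simp flip: of_real_mult)
    ultimately show ?thesis
      by (simp add: a_def field_simps)
  qed
  have half: "(y - (- \<omega> / 2)) / 2 = pi * (2 ^ k * \<phi> - bin_frac (False # xs))"
    by (simp add: y_def \<omega>_def feedback_angle_def field_simps)
  have n1: "(norm (a True))\<^sup>2 = p"
    using assms(2) norm_cis_diff[of "- \<omega> / 2" y] half
    by (simp add: a norm_mult norm_divide power_divide p_def)
  have n2: "(norm (a False))\<^sup>2 = 1 - p"
    using assms(2) norm_cis_add[of "- \<omega> / 2" y] half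
    by (simp add: a norm_mult norm_divide power_divide p_def cos_squared_eq)
  have p01: "0 \<le> p" "p \<le> 1"
    by (auto simp: p_def abs_square_le_1)
  have "norm (sgn (a b)) = 1" if "b \<in> set_pmf (bit_pmf \<phi> k xs)" for b
  proof -
    have "pmf (bernoulli_pmf p) b = (norm (a b))\<^sup>2"
      using p01 n1 n2 by (cases b) auto
    then have "a b \<noteq> 0"
      using that unfolding bit_pmf_def p_def[symmetric] by (auto simp: set_pmf_iff)
    then show ?thesis
      by (simp add: norm_sgn)
  qed
  moreover have "run U (Prepare w (Hadamard w ((CtrlU w ^^ 2 ^ k) (RotZ \<omega> w (Hadamard w
       (Measure w f)))))) (wire_state w \<psi> (\<lambda>b. of_bool (b = b0) * c)) =
    bind_pmf (bit_pmf \<phi> k xs) (\<lambda>b. map_pmf ((#) b)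
       (run U (f b) (wire_state w \<psi> (\<lambda>b'. of_bool (b' = b) * sgn (a b)))))"
  proof -
    have "run U (Prepare w (Hadamard w ((CtrlU w ^^ 2 ^ k) (RotZ \<omega> w (Hadamard w
         (Measure w f)))))) (wire_state w \<psi> (\<lambda>b. of_bool (b = b0) * c)) =
       run U (Measure w f) (wire_state w \<psi> a)"
      unfolding a_def
      by (simp add: reset_wire_state assms bind_return_pmf hadamard_wire_state rz_wire_state
          run_CtrlU_power[OF assms(3)])
    then show ?thesis
      using assms n1 unfolding bit_pmf_def p_def[symmetric]
      by (simp add: outcome_wire_state collapse_wire_state)
  qed
  ultimately show ?thesis
    unfolding \<omega>_def by (intro exI[of _ "\<lambda>b. sgn (a b)"]) blast
qed

text \<open>The bit \<open>b\<close> and the phase \<open>c\<close> are general because each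
  iteration hands a new pair to the next one.\<close>

lemma run_ipea_from:
  fixes \<psi> :: "complex ^ 'n::finite" and w :: "'w::finite"
  assumes "norm \<psi> = 1" "norm c = 1" "U *v \<psi> = cis (2 * pi * \<phi>) *s \<psi>"
  shows "run U (ipea_from w k xs) (wire_state w \<psi> (\<lambda>b'. of_bool (b' = b) * c)) = bits_pmf \<phi> k xs"
  using assms(2)
proof (induction k arbitrary: xs b c)
  case (Suc k)
  obtain d where d: "\<And>b. b \<in> set_pmf (bit_pmf \<phi> k xs) \<Longrightarrow> norm (d b) = 1"
    and run: "run U (ipea_from w (Suc k) xs) (wire_state w \<psi> (\<lambda>b'. of_bool (b' = b) * c)) =
      bind_pmf (bit_pmf \<phi> k xs) (\<lambda>b. map_pmf ((#) b)
       (run U (ipea_from w k (b # xs)) (wire_state w \<psi> (\<lambda>b'. of_bool (b' = b) * d b))))"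
    using run_iteration[OF assms(1) Suc.prems assms(3), of k xs w "\<lambda>x. ipea_from w k (x # xs)" b]
    by auto
  show ?case
    \<comment> \<open>Congruence over the support suffices, and there the new phase has modulus
      1.\<close>
    unfolding run bits_pmf.simps by (intro bind_pmf_cong refl arg_cong2[of _ _ _ _ map_pmf] Suc.IH d)
qed simp

lemma run_ipea:
  fixes \<psi> :: "complex ^ 'n::finite" and w :: "'w::finite"
  assumes "norm \<psi> = 1" "U *v \<psi> = cis (2 * pi * \<phi>) *s \<psi>"
  shows "run U (ipea w m) (initial_state \<psi>) = bits_pmf \<phi> m []"
  using run_ipea_from[of \<psi> 1 U \<phi> w m "[]" False] assms
  by (simp add: ipea_def initial_state_eq_wire_state[of \<psi> w])


section \<open>Resources\<close>

lemma ancillas_ipea_from: "ancillas (ipea_from w k xs) \<subseteq> {w}"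
proof -
  have "ancillas ((CtrlU w ^^ n) C) \<subseteq> insert w (ancillas C)" for n and C :: "'a circuit"
    by (induction n) auto
  then show ?thesis
    by (induction k arbitrary: xs) (simp, fastforce)
qed

lemma num_measurements_ipea_from: "num_measurements (ipea_from w k xs) = k"
proof -
  have "num_measurements ((CtrlU w ^^ n) C) = num_measurements C" for n and C :: "'a circuit"
    by (induction n) auto
  then show ?thesis
    by (induction k arbitrary: xs) auto
qed

text \<open>A geometric sum of powers of two; both measurement branches cost the same, so the
  maximum is harmless.\<close>

lemma num_controlled_ipea_from: "num_controlled (ipea_from w k xs) = 2 ^ k - 1"
proof -
  have "num_controlled ((CtrlU w ^^ n) C) = n + num_controlled C" for n and C :: "'a circuit"
    by (induction n) auto
  then show ?thesis
    by (induction k arbitrary: xs) auto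
qed


section \<open>The distribution of the estimate\<close>

text \<open>Setting the leading bit adds \<open>1 / 2\<close> to the fraction and so turns the angle
  by \<open>pi / 2\<close>, exchanging cosine and sine up to sign.\<close>

lemma pmf_bit_pmf:
  "pmf (bit_pmf \<phi> k xs) b = (cos (pi * (2 ^ k * \<phi> - bin_frac (b # xs))))\<^sup>2"
proof -
  define y where "y = pi * (2 ^ k * \<phi> - bin_frac (False # xs))"
  have "pi * (2 ^ k * \<phi> - bin_frac (True # xs)) = y - pi / 2"
    by (simp add: y_def bin_frac_Cons field_simps)
  then have "(cos (pi * (2 ^ k * \<phi> - bin_frac (b # xs))))\<^sup>2 = (if b then (sin y)\<^sup>2 else (cos y)\<^sup>2)"
    by (simp add: y_def cos_diff)
  then show ?thesis
    by (simp add: bit_pmf_def y_def[symmetric] abs_square_le_1 cos_squared_eq)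
qed

lemma pmf_map_Cons: "pmf (map_pmf ((#) b) M) (c # xs) = of_bool (b = c) * pmf M xs"
proof (cases "b = c")
  case True
  then show ?thesis by (simp add: pmf_map_inj')
next
  case False
  then show ?thesis by (auto simp: pmf_eq_0_set_pmf)
qed

lemma set_bits_pmf: "ys \<in> set_pmf (bits_pmf \<phi> k xs) \<Longrightarrow> length ys = k"
  by (induction k arbitrary: xs ys) auto

text \<open>The reversal appears because the least significant bit is measured first. Factor
  \<open>j\<close> sees exactly the bits known once iteration \<open>j + 1\<close> has
  ended.\<close>

lemma pmf_bits_pmf_rev:
  assumes "length ys = k"
  shows "pmf (bits_pmf \<phi> k xs) (rev ys) =
    (\<Prod>j<k. (cos (pi * (2 ^ j * \<phi> - bin_frac (drop j (ys @ xs)))))\<^sup>2)"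
  using assms
proof (induction k arbitrary: xs ys)
  case (Suc k)
  \<comment> \<open>The last entry is the bit measured first; it then joins the front of
    \<open>xs\<close>.\<close>
  then obtain ys' y where ys: "ys = ys' @ [y]" and len: "length ys' = k"
    by (metis length_Suc_conv_rev)
  have "pmf (bits_pmf \<phi> (Suc k) xs) (rev ys) =
      (\<Sum>b\<in>UNIV. pmf (bits_pmf \<phi> k (b # xs)) (rev ys') * of_bool (b = y) * pmf (bit_pmf \<phi> k xs) b)"
    by (simp add: ys pmf_bind integral_measure_pmf_real[of UNIV] pmf_map_Cons mult_ac)
  also have "\<dots> = pmf (bits_pmf \<phi> k (y # xs)) (rev ys') * pmf (bit_pmf \<phi> k xs) y"
    by (cases y) (simp_all add: UNIV_bool)
  also have "\<dots> = (\<Prod>j<Suc k. (cos (pi * (2 ^ j * \<phi> - bin_frac (drop j (ys @ xs)))))\<^sup>2)"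
    using len by (simp add: Suc.IH pmf_bit_pmf ys)
  finally show ?case .
qed simp

text \<open>Modulo 1, each shifted fraction is a multiple of the full one, so every factor depends
  only on the error of the estimate.\<close>

lemma pmf_bits_pmf:
  assumes "length ys = m"
  shows "pmf (bits_pmf \<phi> m []) (rev ys) = (\<Prod>j<m. (cos (pi * (2 ^ j * (\<phi> - bin_frac ys))))\<^sup>2)"
proof -
  have "(cos (pi * (2 ^ j * \<phi> - bin_frac (drop j ys))))\<^sup>2 = (cos (pi * (2 ^ j * (\<phi> - bin_frac ys))))\<^sup>2"
    if "j < m" for j
    using power_mult_bin_frac[of j ys] that assms
    by (intro cos_squared_cong_Ints) (simp add: algebra_simps)
  then show ?thesis
    using assms by (simp add: pmf_bits_pmf_rev)
qed

lemma prob_ipea_estimate: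
  fixes \<psi> :: "complex ^ 'n::finite" and w :: "'w::finite"
  assumes "norm \<psi> = 1" "U *v \<psi> = cis (2 * pi * \<phi>) *s \<psi>" "length ys = m"
  shows "measure_pmf.prob (ipea_estimate w m U \<psi>) {x. [x = bin_frac ys] (rmod 1)} =
    (\<Prod>j<m. (cos (pi * (2 ^ j * (\<phi> - bin_frac ys))))\<^sup>2)"
    and "measure_pmf.prob (ipea_estimate w m U \<psi>) {x. x = bin_frac ys} =
    (\<Prod>j<m. (cos (pi * (2 ^ j * (\<phi> - bin_frac ys))))\<^sup>2)"
proof -
  have est: "ipea_estimate w m U \<psi> = map_pmf (\<lambda>r. bin_frac (rev r)) (bits_pmf \<phi> m [])"
    by (simp add: ipea_estimate_def run_ipea[OF assms(1,2)])
  \<comment> \<open>Any event that singles out \<open>ys\<close> among the strings of length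
    \<open>m\<close> has this probability; both claims are instances.\<close>
  have *: "measure_pmf.prob (ipea_estimate w m U \<psi>) S =
      (\<Prod>j<m. (cos (pi * (2 ^ j * (\<phi> - bin_frac ys))))\<^sup>2)"
    if S: "\<And>zs. length zs = m \<Longrightarrow> bin_frac zs \<in> S \<longleftrightarrow> zs = ys" for S
  proof -
    have "measure_pmf.prob (ipea_estimate w m U \<psi>) S =
        measure_pmf.prob (bits_pmf \<phi> m []) ((\<lambda>r. bin_frac (rev r)) -` S)"
      by (simp add: est)
    also have "\<dots> = measure_pmf.prob (bits_pmf \<phi> m []) {rev ys}"
    proof (rule measure_prob_cong_0)
      fix r assume "r \<in> (\<lambda>r. bin_frac (rev r)) -` S - {rev ys}"
      then have "length r \<noteq> m"
        using S[of "rev r"] by auto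
      then show "pmf (bits_pmf \<phi> m []) r = 0"
        using set_bits_pmf by (auto simp: pmf_eq_0_set_pmf)
    next
      fix r assume "r \<in> {rev ys} - (\<lambda>r. bin_frac (rev r)) -` S"
      then show "pmf (bits_pmf \<phi> m []) r = 0"
        using S[of ys] assms by auto
    qed
    also have "\<dots> = pmf (bits_pmf \<phi> m []) (rev ys)"
      by (simp add: measure_pmf_single)
    finally show ?thesis
      using assms by (simp add: pmf_bits_pmf)
  qed
  show "measure_pmf.prob (ipea_estimate w m U \<psi>) {x. [x = bin_frac ys] (rmod 1)} =
    (\<Prod>j<m. (cos (pi * (2 ^ j * (\<phi> - bin_frac ys))))\<^sup>2)"
    using bin_frac_rcong_inject assms by (intro *) auto
  show "measure_pmf.prob (ipea_estimate w m U \<psi>) {x. x = bin_frac ys} =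
    (\<Prod>j<m. (cos (pi * (2 ^ j * (\<phi> - bin_frac ys))))\<^sup>2)"
    using bin_frac_inject assms by (intro *) auto
qed

theorem mainTheorem1:
  fixes U :: "complex ^ 'n::finite ^ 'n" and \<psi> :: "complex ^ 'n"
    and w :: "'w::finite"
    and m :: nat and \<phi> \<phi>t \<delta> :: real and estimate :: "real pmf"
  assumes "m \<ge> 1"
    and "unitary U"
    and "norm \<psi> = 1"
    and "U *v \<psi> = exp (2 * of_real pi * \<i> * of_real \<phi>) *s \<psi>"
    and "0 \<le> \<phi>" and "\<phi> < 1"
    and "\<phi>t = truncate_bits m \<phi>"
    and "\<phi> = \<phi>t + \<delta> / 2 ^ m"
    and "0 \<le> \<delta>" and "\<delta> < 1"
    and "estimate = ipea_estimate w m U \<psi>"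
  shows "measure_pmf.prob estimate {x. x = \<phi>t} =
           (\<Prod>k=1..m. (cos (pi * 2 ^ (k - 1) * (\<delta> / 2 ^ m)))\<^sup>2)
    \<and> (\<Prod>k=1..m. (cos (pi * 2 ^ (k - 1) * (\<delta> / 2 ^ m)))\<^sup>2) =
           (if \<delta> = 0 then 1
            else (sin (pi * \<delta>))\<^sup>2 / (2 ^ (2 * m) * (sin (pi * (\<delta> / 2 ^ m)))\<^sup>2))
    \<and> measure_pmf.prob estimate {x. [x = \<phi>t + 1 / 2 ^ m] (rmod 1)} =
           (sin (pi * (1 - \<delta>)))\<^sup>2 / (2 ^ (2 * m) * (sin (pi * ((1 - \<delta>) / 2 ^ m)))\<^sup>2)
    \<and> measure_pmf.prob estimate {x. x = \<phi>t \<or> [x = \<phi>t + 1 / 2 ^ m] (rmod 1)} > 8 / pi\<^sup>2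
    \<and> measure_pmf.prob estimate {x. \<not> (x = \<phi>t \<or> [x = \<phi>t + 1 / 2 ^ m] (rmod 1))} < 1 - 8 / pi\<^sup>2
    \<and> card (ancillas (ipea w m)) = 1
    \<and> (\<lambda>n. real (num_measurements (ipea w n))) \<in> O(\<lambda>n. real n)
    \<and> (\<lambda>n. real (num_controlled (ipea w n))) \<in> O(\<lambda>n. 2 ^ n)"
proof -
  let ?ratio = "\<lambda>t. (sin (pi * t))\<^sup>2 / (2 ^ (2 * m) * (sin (pi * (t / 2 ^ m)))\<^sup>2)"
  have m: "0 < m"
    using assms(1) by simp
  have eig: "U *v \<psi> = cis (2 * pi * \<phi>) *s \<psi>"
    using assms(4) by (simp add: cis_conv_exp mult_ac)
  note prob = prob_ipea_estimate[OF assms(3) eig, where w = w]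
  define bs where "bs = map (binary_digit \<phi>) [1..<Suc m]"
  have bs: "length bs = m" "bin_frac bs = \<phi>t"
    using assms(7) by (simp_all add: bs_def truncate_bits_def)
  obtain cs where cs: "length cs = m" "[bin_frac cs = \<phi>t + 1 / 2 ^ m] (rmod 1)"
    using bin_frac_successor[of bs] bs by auto

  have reindex: "(\<Prod>k=1..m. (cos (pi * 2 ^ (k - 1) * (\<delta> / 2 ^ m)))\<^sup>2) =
      (\<Prod>k<m. (cos (pi * (2 ^ k * (\<delta> / 2 ^ m))))\<^sup>2)"
    by (rule prod.reindex_bij_witness[of _ Suc "\<lambda>k. k - 1"]) (auto simp: mult.assoc)
  have down: "measure_pmf.prob estimate {x. x = \<phi>t} =
      (\<Prod>k<m. (cos (pi * (2 ^ k * (\<delta> / 2 ^ m))))\<^sup>2)"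
    using prob(2)[OF bs(1)] assms(8) by (simp add: bs assms(11))
  have ratio: "(\<Prod>k<m. (cos (pi * (2 ^ k * (\<delta> / 2 ^ m))))\<^sup>2) = (if \<delta> = 0 then 1 else ?ratio \<delta>)"
    using prod_cos_squared[of \<delta> m] assms(9,10) m by simp

  have "{x. [x = bin_frac cs] (rmod 1)} = {x. [x = \<phi>t + 1 / 2 ^ m] (rmod 1)}"
    using cs(2) rcong_trans rcong_sym by blast
  then have "measure_pmf.prob estimate {x. [x = \<phi>t + 1 / 2 ^ m] (rmod 1)} =
      (\<Prod>j<m. (cos (pi * (2 ^ j * (\<phi> - bin_frac cs))))\<^sup>2)"
    using prob(1)[OF cs(1)] by (simp add: assms(11))
  also have "\<dots> = (\<Prod>j<m. (cos (pi * (2 ^ j * ((1 - \<delta>) / 2 ^ m))))\<^sup>2)"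
  proof (rule prod.cong[OF refl])
    fix j
    obtain n :: int where "\<phi>t + 1 / 2 ^ m = bin_frac cs + of_int n"
      using cs(2) by (auto simp: rcong_altdef)
    \<comment> \<open>The integer \<open>n\<close> absorbs a possible wrap-around; the minus sign
      disappears because the cosine is even.\<close>
    then have n: "\<phi> - bin_frac cs = of_int n - (1 - \<delta>) / 2 ^ m"
      using assms(8) by (simp add: diff_divide_distrib)
    have "2 ^ j * (\<phi> - bin_frac cs) - (- (2 ^ j * ((1 - \<delta>) / 2 ^ m))) = 2 ^ j * of_int n"
      unfolding n by (simp add: right_diff_distrib)
    also have "\<dots> \<in> \<int>"
      by simp
    finally show "(cos (pi * (2 ^ j * (\<phi> - bin_frac cs))))\<^sup>2 = (cos (pi * (2 ^ j * ((1 - \<delta>) / 2 ^ m))))\<^sup>2"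
      by (simp only: cos_squared_cong_Ints mult_minus_right cos_minus)
  qed
  also have "\<dots> = ?ratio (1 - \<delta>)"
    using assms(9,10) m by (intro prod_cos_squared) auto
  finally have up: "measure_pmf.prob estimate {x. [x = \<phi>t + 1 / 2 ^ m] (rmod 1)} = ?ratio (1 - \<delta>)" .

  let ?near = "{x. x = \<phi>t \<or> [x = \<phi>t + 1 / 2 ^ m] (rmod 1)}"
  \<comment> \<open>The two events are disjoint because \<open>1 / 2 ^ m\<close> lies strictly
    between 0 and 1, so the probabilities add.\<close>
  have "\<not> [\<phi>t = \<phi>t + 1 / 2 ^ m] (rmod 1)"
  proof
    assume "[\<phi>t = \<phi>t + 1 / 2 ^ m] (rmod 1)"
    then obtain n :: int where "1 / 2 ^ m = real_of_int n"
      by (auto simp: rcong_altdef)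
    moreover have "0 < 1 / (2::real) ^ m" "1 / (2::real) ^ m < 1"
      using one_less_power[of "2::real" m] m by auto
    ultimately show False
      by simp
  qed
  then have "measure_pmf.prob estimate ({x. x = \<phi>t} \<union> {x. [x = \<phi>t + 1 / 2 ^ m] (rmod 1)}) =
      measure_pmf.prob estimate {x. x = \<phi>t} +
      measure_pmf.prob estimate {x. [x = \<phi>t + 1 / 2 ^ m] (rmod 1)}"
    by (intro measure_pmf.finite_measure_Union) auto
  also have "\<dots> = (if \<delta> = 0 then 1 else ?ratio \<delta>) + ?ratio (1 - \<delta>)"
    unfolding down ratio up ..
  also have "\<dots> > 8 / pi\<^sup>2"
  proof (cases "\<delta> = 0")
    \<comment> \<open>The truncation is exact and has probability 1, so only
      \<open>8 < pi\<^sup>2\<close> remains.\<close>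
    case True
    have "3\<^sup>2 < pi\<^sup>2"
      using pi_approx by (intro power_strict_mono) auto
    then have "8 / pi\<^sup>2 < 1"
      by (simp add: divide_less_eq)
    with True show ?thesis
      by simp
  next
    case False
    then show ?thesis
      using sin_ratio_sum_gt[of \<delta> m] assms(9,10) m by simp
  qed
  also have "{x. x = \<phi>t} \<union> {x. [x = \<phi>t + 1 / 2 ^ m] (rmod 1)} = ?near"
    by auto
  finally have near: "8 / pi\<^sup>2 < measure_pmf.prob estimate ?near" .
  have far: "measure_pmf.prob estimate {x. \<not> (x = \<phi>t \<or> [x = \<phi>t + 1 / 2 ^ m] (rmod 1))} =
      1 - measure_pmf.prob estimate ?near"
    using measure_pmf.prob_compl[of ?near estimate] by (simp add: Compl_eq Compl_eq_Diff_UNIV[symmetric])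

  have "ancillas (ipea w m) \<noteq> {}"
    using m by (cases m) (auto simp: ipea_def)
  then have "ancillas (ipea w m) = {w}"
    using ancillas_ipea_from[of w m "[]"] by (auto simp: ipea_def)
  moreover have "(\<lambda>n. real (num_controlled (ipea w n))) \<in> O(\<lambda>n. 2 ^ n)"
    by (intro landau_o.big_mono always_eventually)
      (auto simp: ipea_def num_controlled_ipea_from of_nat_diff)
  ultimately show ?thesis
    using near unfolding reindex down ratio up far
    by (simp add: ipea_def num_measurements_ipea_from)
qed

end
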